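(* Let $r$ be a natural number and let $G=(V,E)$ be a graph on the vertex set $V=\{1,\dots,r\}$. Let $\mathbf{s}=(s_1,\dots,s_r)\in\mathbb{C}^r$ with $\operatorname{Re}s_j>1$ for $1\le j\le r$. Then $$\zeta(s_1)^{-1}\cdots\zeta(s_r)^{-1}D_G(\mathbf{s})=\prod_p\ \sum_{U\subset E}(-1)^{|U|}\prod_{j\in\operatorname{ver}U}p^{-s_j},$$ where the first product is over all primes $p$. The Euler product on the right hand side converges absolutely in the region $\operatorname{Re}s_j>\frac12$ $(1\le j\le r)$, and constitutes an analytic continuation of the function $\Xi_G(\mathbf{s})=\zeta(s_1)^{-1}\cdots\zeta(s_r)^{-1}D_G(\mathbf{s})$ to this set.
   Context: Graphs are simple: $E$ is a set of pairs $(k,l)$ of distinct vertices, regarded as undirected edges. For a subset $U\subset E$, $\operatorname{ver}U\subset V$ denotes the set of all vertices that are adjacent to (i.e. endpoints of) at least one edge in $U$; empty products equal $1$. For complex $s_1,\dots,s_r$ with $\operatorname{Re}s_j>1$, $$D_G(s_1,\dots,s_r)=\sum_{\substack{n_1,\dots,n_r\ge1\\ \gcd(n_k,n_l)=1\text{ for all }(k,l)\in E}}n_1^{-s_1}n_2^{-s_2}\cdots n_r^{-s_r},$$ an absolutely convergent series. $\zeta$ is the Riemann zeta function. *)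

theory Defs
  imports "HOL-Analysis.Analysis" "HOL-Computational_Algebra.Primes"
begin

text \<open>
  The vertex set \<open>{1,\<dots>,r}\<close> is rendered as a finite type \<open>'n\<close> with \<open>r = CARD('n)\<close>, so that
  \<open>\<complex>\<^sup>r\<close> is the normed space \<open>complex ^ 'n\<close>.  An undirected edge \<open>(k,l)\<close> is the unordered
  pair \<open>{k,l}\<close>.
\<close>

definition simple_graph :: "'n set set \<Rightarrow> bool" where
  "simple_graph E \<longleftrightarrow> (\<forall>e\<in>E. \<exists>k l. k \<noteq> l \<and> e = {k, l})"

definition ver :: "'n set set \<Rightarrow> 'n set" where
  "ver U = {j. \<exists>e\<in>U. j \<in> e}"

definition half_space :: "real \<Rightarrow> (complex ^ 'n) set" where
  "half_space a = {s. \<forall>j. Re (s $ j) > a}"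

text \<open>
  The Riemann zeta function in its half-plane of absolute convergence \<open>Re s > 1\<close>, given by its
  Dirichlet series; outside that half-plane the value is meaningless.
\<close>

definition zeta :: "complex \<Rightarrow> complex" where
  "zeta s = (\<Sum>\<^sub>\<infinity>n\<in>{n::nat. n \<ge> 1}. of_nat n powr (- s))"

definition D_G :: "'n::finite set set \<Rightarrow> complex ^ 'n \<Rightarrow> complex" where
  "D_G E s = (\<Sum>\<^sub>\<infinity>n\<in>{n :: 'n \<Rightarrow> nat. (\<forall>j. n j \<ge> 1) \<and> (\<forall>k l. {k, l} \<in> E \<longrightarrow> gcd (n k) (n l) = 1)}.
     \<Prod>j\<in>UNIV. of_nat (n j) powr (- (s $ j)))"

definition Xi_G :: "'n::finite set set \<Rightarrow> complex ^ 'n \<Rightarrow> complex" where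
  "Xi_G E s = (\<Prod>j\<in>UNIV. inverse (zeta (s $ j))) * D_G E s"

definition euler_factor :: "'n::finite set set \<Rightarrow> complex ^ 'n \<Rightarrow> nat \<Rightarrow> complex" where
  "euler_factor E s p = (\<Sum>U\<in>Pow E. (- 1) ^ card U * (\<Prod>j\<in>ver U. of_nat p powr (- (s $ j))))"

text \<open>
  A product over all primes is an infinite product over \<^typ>\<open>nat\<close> with factor 1 at the
  non-primes.
\<close>

definition prime_factor_seq :: "(nat \<Rightarrow> complex) \<Rightarrow> nat \<Rightarrow> complex" where
  "prime_factor_seq f p = (if prime p then f p else 1)"

text \<open>
  Analyticity in several complex variables: near each point, \<open>f\<close> has a Frechet derivative that
  is complex linear (for one variable this is \<^const>\<open>analytic_on\<close>).  On an open set
  the neighbourhood of each point is supplied by the set itself.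
\<close>

definition analytic_on_open :: "(complex ^ 'n::finite \<Rightarrow> complex) \<Rightarrow> (complex ^ 'n) set \<Rightarrow> bool" where
  "analytic_on_open f S \<longleftrightarrow> open S \<and>
     (\<forall>s\<in>S. \<exists>f'. (f has_derivative f') (at s) \<and> (\<forall>c v. f' (c *s v) = c * f' v))"

definition analytic_continuation ::
  "(complex ^ 'n::finite \<Rightarrow> complex) \<Rightarrow> (complex ^ 'n) set \<Rightarrow>
   (complex ^ 'n \<Rightarrow> complex) \<Rightarrow> (complex ^ 'n) set \<Rightarrow> bool" where
  "analytic_continuation f S g T \<longleftrightarrow>
     S \<noteq> {} \<and> S \<subseteq> T \<and> connected T \<and>
     analytic_on_open f S \<and> analytic_on_open g T \<and> (\<forall>s\<in>S. g s = f s)"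

end

theory Submission imports Defs begin

text \<open>
  Start from the product of the zeta values, which for \<open>Re s\<^sub>j > 1\<close> is the sum of
  \<open>\<Prod>\<^sub>j n\<^sub>j powr (-s\<^sub>j)\<close> over all tuples of positive integers, and sieve: for one prime \<open>p\<close> after the
  other, discard the tuples in which \<open>p\<close> divides both entries of some edge.  By inclusion-exclusion over
  sets \<open>U\<close> of edges, and because the tuples whose entries over \<open>ver U\<close> are divisible by \<open>p\<close> are obtained
  by multiplying these entries by \<open>p\<close>, each step multiplies the sum by exactly the Euler factor at \<open>p\<close>
  (\<open>infsum_sieved_insert\<close>).  After all primes only the tuples with coprime entries along the edges
  are left, so \<open>D_G\<close> is the product of the zeta values times the Euler product
  (\<open>sieved_products_tendsto\<close>, \<open>D_G_eq_infsum_sieved\<close>).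

  The sieve works for any family of vertex sets in place of the edges.  With all singletons, it leaves
  just the tuple of ones, whose sum is \<open>1\<close>; hence the zeta values do not vanish
  (\<open>prod_zeta_nonzero\<close>) and one may divide by them.

  For the continuation, a nonempty set of edges covers at least two vertices.  So if \<open>Re s\<^sub>j > a > 1/2\<close>
  for all \<open>j\<close>, the Euler factor at \<open>p\<close> differs from \<open>1\<close> by \<open>O(p powr (-2 * a))\<close>, and its derivative is
  \<open>O(ln p * p powr (-2 * a))\<close> (\<open>euler_factor_bounds\<close>).  Both are summable, so the product converges
  absolutely, and differentiating the logarithm of its tail term by term shows that it is analytic
  (\<open>analytic_on_open_prodinf\<close>).
\<close>

section \<open>Infinite sums\<close>

lemma has_sum_sum:
  fixes f :: "'i \<Rightarrow> 'a \<Rightarrow> 'b::topological_comm_monoid_add"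
  assumes "finite I" "\<And>i. i \<in> I \<Longrightarrow> (f i has_sum a i) A"
  shows   "((\<lambda>x. \<Sum>i\<in>I. f i x) has_sum (\<Sum>i\<in>I. a i)) A"
  using assms by (induction I) (auto intro!: has_sum_add)

text \<open>
  Only finitely many points carry all but \<open>\<epsilon>/2\<close> of the absolute mass outside the intersection,
  and each of them has left \<open>A N\<close> for large \<open>N\<close>.
\<close>

lemma infsum_decseq_tendsto:
  fixes f :: "'a \<Rightarrow> complex"
  assumes f: "f summable_on A 0" and A: "decseq A"
  shows   "(\<lambda>N. infsum f (A N)) \<longlonglongrightarrow> infsum f (\<Inter>N. A N)"
proof (rule tendstoI)
  fix e :: real assume e: "e > 0"
  let ?I = "\<Inter>N. A N"
  have abs: "(\<lambda>x. norm (f x)) summable_on A 0"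
    using f summable_on_iff_abs_summable_on_complex by blast
  have "(\<lambda>x. norm (f x)) summable_on (A 0 - ?I)"
    by (rule summable_on_subset_banach[OF abs]) auto
  from infsum_finite_approximation[OF this, of "e/2"] e
  obtain F where F: "finite F" "F \<subseteq> A 0 - ?I"
    "dist (\<Sum>x\<in>F. norm (f x)) (\<Sum>\<^sub>\<infinity>x\<in>A 0 - ?I. norm (f x)) \<le> e / 2"
    by auto
  have "eventually (\<lambda>N. x \<notin> A N) sequentially" if "x \<in> F" for x
  proof -
    from that F obtain M where "x \<notin> A M"
      by auto
    thus ?thesis
      using A by (intro eventually_sequentiallyI[of M]) (auto simp: decseq_def)
  qed
  hence "eventually (\<lambda>N. \<forall>x\<in>F. x \<notin> A N) sequentially"
    using F(1) by (simp add: eventually_ball_finite)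
  thus "eventually (\<lambda>N. dist (infsum f (A N)) (infsum f ?I) < e) sequentially"
  proof eventually_elim
    case (elim N)
    have sub: "A N \<subseteq> A 0"
      using A by (auto simp: decseq_def)
    have S: "f summable_on B" "(\<lambda>x. norm (f x)) summable_on B" if "B \<subseteq> A 0" for B
      using that f abs by (auto intro: summable_on_subset_banach)
    have "infsum f (A N) - infsum f ?I = infsum f (A N - ?I)"
      using sub by (intro infsum_Diff[symmetric] S) blast+
    hence "dist (infsum f (A N)) (infsum f ?I) \<le> (\<Sum>\<^sub>\<infinity>x\<in>A N - ?I. norm (f x))"
      using norm_infsum_bound[of f "A N - ?I"] S(2)[of "A N - ?I"] sub
      by (simp only: dist_norm) blast
    also have "\<dots> \<le> (\<Sum>\<^sub>\<infinity>x\<in>(A 0 - ?I) - F. norm (f x))"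
    proof (rule infsum_mono2)
      show "A N - ?I \<subseteq> (A 0 - ?I) - F"
        using elim sub by blast
    qed (use sub in \<open>blast intro: S(2)\<close>, blast intro: S(2), simp)
    also have "\<dots> = (\<Sum>\<^sub>\<infinity>x\<in>A 0 - ?I. norm (f x)) - (\<Sum>x\<in>F. norm (f x))"
    proof -
      have "(\<Sum>\<^sub>\<infinity>x\<in>(A 0 - ?I) - F. norm (f x))
          = (\<Sum>\<^sub>\<infinity>x\<in>A 0 - ?I. norm (f x)) - (\<Sum>\<^sub>\<infinity>x\<in>F. norm (f x))"
        using F(2) by (intro infsum_Diff S(2)) blast+
      thus ?thesis
        using F(1) by simp
    qed
    also have "\<dots> < e"
      using F(3) e unfolding dist_real_def by linarith
    finally show ?case .
  qed
qed

section \<open>Sieving the Dirichlet series by primes\<close>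

definition dirichlet_term :: "complex ^ 'n::finite \<Rightarrow> ('n \<Rightarrow> nat) \<Rightarrow> complex" where
  "dirichlet_term s n = (\<Prod>j\<in>UNIV. of_nat (n j) powr (- (s $ j)))"

text \<open>
  The family \<open>E\<close> may consist of arbitrary vertex sets, not only of pairs: a prime \<open>p\<close> in \<open>P\<close> must not
  divide all the entries over any one member of \<open>E\<close>.  For the edges of a graph and all primes this is
  the coprimality condition of the series \<^const>\<open>D_G\<close>; for the family of all singletons it leaves just
  the tuple of ones, and that case yields the nonvanishing of the zeta function.
\<close>

definition sieved :: "nat set \<Rightarrow> 'n set set \<Rightarrow> ('n \<Rightarrow> nat) set" where
  "sieved P E = {n. (\<forall>j. n j \<ge> 1) \<and> (\<forall>p\<in>P. prime p \<longrightarrow> (\<forall>e\<in>E. \<exists>j\<in>e. \<not> p dvd n j))}"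

lemma sieved_subset: "sieved P E \<subseteq> sieved {} E"
  by (auto simp: sieved_def)

lemma of_nat_mult_powr:
  "of_nat (a * b) powr (z :: complex) = of_nat a powr z * of_nat b powr z"
  by (simp add: powr_times_real)

lemma norm_of_nat_powr: "norm (of_nat m powr (z :: complex)) = real m powr Re z"
  by (simp add: norm_powr_real_powr)

lemma zeta_abs_summable:
  assumes "Re z > 1"
  shows   "Infinite_Sum.abs_summable_on (\<lambda>n. of_nat n powr (- z)) {n::nat. n \<ge> 1}"
proof -
  have "summable (\<lambda>n. norm (of_nat n powr (- z)))"
    using assms by (simp add: norm_of_nat_powr summable_real_powr_iff)
  hence "(\<lambda>n. norm (of_nat n powr (- z))) summable_on UNIV"
    by (intro norm_summable_imp_summable_on) simp
  thus ?thesis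
    by (rule summable_on_subset_banach) simp
qed

lemma sieved_empty_eq_PiE: "sieved {} E = PiE UNIV (\<lambda>_. {n. n \<ge> 1})"
  by (auto simp: sieved_def PiE_def Pi_def)

lemma dirichlet_term_summable:
  assumes "s \<in> half_space 1"
  shows   "dirichlet_term s summable_on sieved P E"
proof -
  have "Infinite_Set_Sum.abs_summable_on (\<lambda>n. \<Prod>j\<in>UNIV. of_nat (n j) powr (- (s $ j)))
          (PiE UNIV (\<lambda>_. {n::nat. n \<ge> 1}))"
  proof (rule abs_summable_on_prod_PiE)
    fix j :: 'a
    have "Re (s $ j) > 1"
      using assms by (simp add: half_space_def)
    thus "Infinite_Set_Sum.abs_summable_on (\<lambda>n::nat. of_nat n powr (- (s $ j))) {n. n \<ge> 1}"
      using zeta_abs_summable abs_summable_equivalent by blast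
  qed auto
  hence "Infinite_Sum.abs_summable_on (dirichlet_term s) (sieved {} E)"
    unfolding sieved_empty_eq_PiE dirichlet_term_def abs_summable_equivalent .
  hence "dirichlet_term s summable_on sieved {} E"
    by (rule abs_summable_summable)
  thus ?thesis
    by (rule summable_on_subset_banach) (rule sieved_subset)
qed

lemma infsum_sieved_empty:
  assumes "s \<in> half_space 1"
  shows   "infsum (dirichlet_term s) (sieved {} E) = (\<Prod>j\<in>UNIV. zeta (s $ j))"
  unfolding sieved_empty_eq_PiE dirichlet_term_def zeta_def
proof (rule infsum_prod_PiE_abs)
  fix j
  show "Infinite_Sum.abs_summable_on (\<lambda>n::nat. of_nat n powr (- (s $ j))) {n. n \<ge> 1}"
    using assms by (intro zeta_abs_summable) (simp add: half_space_def)
qed auto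

text \<open>
  The tuples whose entries over \<open>W\<close> are multiples of \<open>p\<close> arise from arbitrary ones by multiplying
  these entries by \<open>p\<close>.  As \<open>p\<close> is not in \<open>P\<close>, the conditions for the primes in \<open>P\<close> do not notice this
  factor, so the only effect on the sum is the factor contributed by \<open>p\<close> to each summand.
\<close>

lemma infsum_sieved_multiples:
  fixes s :: "complex ^ 'n::finite" and W :: "'n set"
  assumes p: "prime p" "p \<notin> P"
  shows "infsum (dirichlet_term s) {n \<in> sieved P E. \<forall>j\<in>W. p dvd n j}
           = (\<Prod>j\<in>W. of_nat p powr (- (s $ j))) * infsum (dirichlet_term s) (sieved P E)"
proof -
  define c where "c = (\<Prod>j\<in>W. of_nat p powr (- (s $ j)))"
  define lift where "lift = (\<lambda>(m :: 'n \<Rightarrow> nat) j. if j \<in> W then p * m j else m j)"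
  define lower where "lower = (\<lambda>(n :: 'n \<Rightarrow> nat) j. if j \<in> W then n j div p else n j)"
  have p0: "p > 0"
    using p(1) prime_gt_0_nat by blast
  have dvd_lift: "q dvd lift m j \<longleftrightarrow> q dvd m j" if "q \<in> P" "prime q" for q m j
  proof -
    have "\<not> q dvd p"
      using that p primes_dvd_imp_eq by blast
    thus ?thesis
      using that by (auto simp: lift_def prime_dvd_mult_iff)
  qed
  have lift_sieved: "lift m \<in> sieved P E" if "m \<in> sieved P E" for m
    using that p0 dvd_lift by (auto simp: sieved_def) (auto simp: lift_def Suc_le_eq)
  have lift_sieved_iff: "lift m \<in> sieved P E \<longleftrightarrow> m \<in> sieved P E" for m
  proof
    assume "lift m \<in> sieved P E"
    moreover from this have "m j \<ge> 1" for j
      by (auto simp: sieved_def lift_def Suc_le_eq dest: spec[of _ j] split: if_splits)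
    ultimately show "m \<in> sieved P E"
      using dvd_lift by (auto simp: sieved_def)
  qed (rule lift_sieved)
  have "infsum (\<lambda>m. c * dirichlet_term s m) (sieved P E)
      = infsum (dirichlet_term s) {n \<in> sieved P E. \<forall>j\<in>W. p dvd n j}"
  proof (rule infsum_reindex_bij_witness[where i = lower and j = lift])
    fix m assume m: "m \<in> sieved P E"
    show "lower (lift m) = m"
      using p0 by (auto simp: lower_def lift_def)
    show "lift m \<in> {n \<in> sieved P E. \<forall>j\<in>W. p dvd n j}"
      using m by (simp add: lift_sieved) (simp add: lift_def)
    have "dirichlet_term s (lift m)
        = (\<Prod>j\<in>UNIV. (if j \<in> W then of_nat p powr (- (s $ j)) else 1)
             * of_nat (m j) powr (- (s $ j)))"
      unfolding dirichlet_term_def lift_def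
      by (intro prod.cong refl) (auto simp del: of_nat_mult simp: of_nat_mult_powr)
    also have "\<dots> = c * dirichlet_term s m"
      by (simp add: prod.distrib c_def dirichlet_term_def prod.If_cases)
    finally show "dirichlet_term s (lift m) = c * dirichlet_term s m" .
  next
    fix n assume n: "n \<in> {n \<in> sieved P E. \<forall>j\<in>W. p dvd n j}"
    show eq: "lift (lower n) = n"
      using n by (auto simp: lower_def lift_def)
    show "lower n \<in> sieved P E"
      using n eq lift_sieved_iff[of "lower n"] by simp
  qed
  thus ?thesis
    by (simp add: infsum_cmult_right' c_def)
qed

text \<open>
  Expand the product of \<open>1 - [Q holds on all of e]\<close> over the members \<open>e\<close> of \<open>E\<close>; \<open>Q\<close> holds on all
  members of \<open>U\<close> exactly if it holds on \<open>ver U\<close>.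
\<close>

lemma inclusion_exclusion_ver:
  fixes E :: "'n::finite set set"
  shows "(\<Sum>U\<in>Pow E. (- 1) ^ card U * of_bool (\<forall>j\<in>ver U. Q j))
           = (of_bool (\<forall>e\<in>E. \<exists>j\<in>e. \<not> Q j) :: complex)"
proof -
  have bool: "(\<Prod>e\<in>U. of_bool (R e)) = (of_bool (\<forall>e\<in>U. R e) :: complex)"
    for U :: "'n set set" and R
    using finite[of U] by (induction U rule: finite_induct) auto
  have "(of_bool (\<forall>e\<in>E. \<exists>j\<in>e. \<not> Q j) :: complex) = (\<Prod>e\<in>E. 1 - of_bool (\<forall>j\<in>e. Q j))"
    unfolding bool[symmetric] by (intro prod.cong) auto
  also have "\<dots> = (\<Sum>U\<in>Pow E. (- 1) ^ card U * (\<Prod>e\<in>U. of_bool (\<forall>j\<in>e. Q j)))"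
    by (subst prod_diff_conv_sum) simp_all
  also have "\<dots> = (\<Sum>U\<in>Pow E. (- 1) ^ card U * of_bool (\<forall>j\<in>ver U. Q j))"
    unfolding bool by (intro sum.cong refl arg_cong2[of _ _ _ _ "(*)"] arg_cong[of _ _ of_bool])
                      (auto simp: ver_def)
  finally show ?thesis ..
qed

text \<open>
  This is where the Euler factor comes from: inclusion-exclusion over the members of \<open>E\<close> on which
  \<open>p\<close> divides all entries, where each term is a multiple of the sum sieved by \<open>P\<close> alone.
\<close>

lemma infsum_sieved_insert:
  fixes E :: "'n::finite set set"
  assumes s: "s \<in> half_space 1" and p: "prime p" "p \<notin> P"
  shows "infsum (dirichlet_term s) (sieved (insert p P) E)
           = euler_factor E s p * infsum (dirichlet_term s) (sieved P E)"
proof -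
  define m where "m = (\<lambda>U n. of_bool (\<forall>j\<in>ver U. p dvd n j) * dirichlet_term s n)"
  have m_sum: "(m U has_sum (\<Prod>j\<in>ver U. of_nat p powr (- (s $ j)))
                  * infsum (dirichlet_term s) (sieved P E)) (sieved P E)" for U :: "'n set set"
  proof -
    let ?A = "{n \<in> sieved P E. \<forall>j\<in>ver U. p dvd n j}"
    have "dirichlet_term s summable_on ?A"
      by (rule summable_on_subset_banach[OF dirichlet_term_summable[OF s]]) auto
    hence "(dirichlet_term s has_sum infsum (dirichlet_term s) ?A) ?A"
      by (rule has_sum_infsum)
    also have "?this \<longleftrightarrow> (m U has_sum infsum (dirichlet_term s) ?A) (sieved P E)"
      by (rule has_sum_cong_neutral) (auto simp: m_def)
    finally show ?thesis
      by (simp only: infsum_sieved_multiples[OF p])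
  qed
  have "infsum (dirichlet_term s) (sieved (insert p P) E)
      = infsum (\<lambda>n. \<Sum>U\<in>Pow E. (- 1) ^ card U * m U n) (sieved P E)"
  proof (rule infsum_cong_neutral)
    have eq: "(\<Sum>U\<in>Pow E. (- 1) ^ card U * m U n)
            = of_bool (\<forall>e\<in>E. \<exists>j\<in>e. \<not> p dvd n j) * dirichlet_term s n" for n
      by (simp only: m_def inclusion_exclusion_ver[symmetric] sum_distrib_right mult.assoc)
    have iff: "n \<in> sieved (insert p P) E \<longleftrightarrow>
                 n \<in> sieved P E \<and> (\<forall>e\<in>E. \<exists>j\<in>e. \<not> p dvd n j)" for n
      using p(1) by (simp add: sieved_def conj_ac)
    show "(\<Sum>U\<in>Pow E. (- 1) ^ card U * m U n) = 0"
      if "n \<in> sieved P E - sieved (insert p P) E" for n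
      using that unfolding eq by (simp add: iff)
    show "dirichlet_term s n = (\<Sum>U\<in>Pow E. (- 1) ^ card U * m U n)"
      if "n \<in> sieved (insert p P) E \<inter> sieved P E" for n
      using that unfolding eq by (simp add: iff)
  qed (auto simp: sieved_def)
  also have "\<dots> = (\<Sum>U\<in>Pow E. (- 1) ^ card U * ((\<Prod>j\<in>ver U. of_nat p powr (- (s $ j)))
                  * infsum (dirichlet_term s) (sieved P E)))"
    by (intro infsumI has_sum_sum has_sum_cmult_right m_sum) simp
  also have "\<dots> = euler_factor E s p * infsum (dirichlet_term s) (sieved P E)"
    by (simp only: euler_factor_def sum_distrib_right mult.assoc)
  finally show ?thesis .
qed

lemma infsum_sieved_lessThan:
  fixes E :: "'n::finite set set"
  assumes "s \<in> half_space 1"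
  shows "infsum (dirichlet_term s) (sieved {..<N} E)
           = (\<Prod>p<N. prime_factor_seq (euler_factor E s) p) * (\<Prod>j\<in>UNIV. zeta (s $ j))"
proof (induction N)
  case 0
  show ?case
    using infsum_sieved_empty[OF assms] by simp
next
  case (Suc N)
  show ?case
  proof (cases "prime N")
    case True
    thus ?thesis
      using Suc infsum_sieved_insert[OF assms, of N "{..<N}" E]
      by (simp add: lessThan_Suc prime_factor_seq_def mult_ac)
  next
    case False
    hence "sieved {..<Suc N} E = sieved {..<N} E"
      by (auto simp: sieved_def lessThan_Suc)
    thus ?thesis
      using Suc False by (simp add: prime_factor_seq_def)
  qed
qed

text \<open>
  Sieving by more and more primes shrinks the index set to \<open>sieved UNIV E\<close>, while the sum is
  multiplied by one Euler factor after the other.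
\<close>

lemma sieved_products_tendsto:
  fixes E :: "'n::finite set set"
  assumes "s \<in> half_space 1"
  shows "(\<lambda>N. (\<Prod>p<N. prime_factor_seq (euler_factor E s) p) * (\<Prod>j\<in>UNIV. zeta (s $ j)))
           \<longlonglongrightarrow> infsum (dirichlet_term s) (sieved UNIV E)"
proof -
  have "(\<lambda>N. infsum (dirichlet_term s) (sieved {..<N} E))
          \<longlonglongrightarrow> infsum (dirichlet_term s) (\<Inter>N. sieved {..<N} E)"
  proof (rule infsum_decseq_tendsto)
    show "decseq (\<lambda>N. sieved {..<N} E)"
      by (intro decseq_SucI) (auto simp: sieved_def)
  qed (rule dirichlet_term_summable[OF assms])
  also have "(\<Inter>N. sieved {..<N} E) = sieved UNIV E"
  proof -
    have "(\<forall>N. \<forall>p\<in>{..<N}. Q p) \<longleftrightarrow> (\<forall>p. Q p)" for Q :: "nat \<Rightarrow> bool"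
      by (meson lessI lessThan_iff)
    thus ?thesis
      by (simp add: sieved_def set_eq_iff)
  qed
  finally show ?thesis
    by (simp only: infsum_sieved_lessThan[OF assms])
qed

lemma sieved_UNIV_singletons: "sieved UNIV (range (\<lambda>j. {j})) = {\<lambda>_. 1}"
proof -
  have "n j = 1" if "n \<in> sieved UNIV (range (\<lambda>j. {j}))" for n :: "'a \<Rightarrow> nat" and j
    using that prime_factor_nat[of "n j"] by (auto simp: sieved_def)
  thus ?thesis
    by (auto simp: sieved_def)
qed

text \<open>
  Sieving by the family of singletons leaves only the tuple \<open>(1,\<dots>,1)\<close>, so the partial products times
  the zeta values tend to \<open>1\<close>; a vanishing zeta value would make them all \<open>0\<close>.
\<close>

lemma prod_zeta_nonzero:
  fixes s :: "complex ^ 'n::finite"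
  assumes "s \<in> half_space 1"
  shows "(\<Prod>j\<in>UNIV. zeta (s $ j)) \<noteq> 0"
proof
  assume "(\<Prod>j\<in>UNIV. zeta (s $ j)) = 0"
  hence "(\<lambda>_::nat. 0) \<longlonglongrightarrow> infsum (dirichlet_term s) {\<lambda>_. 1}"
    using sieved_products_tendsto[OF assms, of "range (\<lambda>j. {j})"]
    by (simp only: sieved_UNIV_singletons mult_zero_right)
  moreover have "infsum (dirichlet_term s) {\<lambda>_. 1} = 1"
    by (simp add: dirichlet_term_def)
  ultimately show False
    by (simp add: LIMSEQ_const_iff)
qed

lemma D_G_eq_infsum_sieved:
  assumes "simple_graph E"
  shows "D_G E s = infsum (dirichlet_term s) (sieved UNIV E)"
proof -
  have coprime: "gcd a b = 1 \<longleftrightarrow> (\<forall>p. prime p \<longrightarrow> \<not> p dvd a \<or> \<not> p dvd b)" for a b :: nat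
  proof -
    have "gcd a b = 1 \<longleftrightarrow> (\<forall>p. prime p \<longrightarrow> \<not> p dvd gcd a b)"
      using prime_factor_nat[of "gcd a b"] by fastforce
    thus ?thesis
      by (simp only: gcd_greatest_iff de_Morgan_conj)
  qed
  have edges: "(\<forall>e\<in>E. Q e) \<longleftrightarrow> (\<forall>k l. {k, l} \<in> E \<longrightarrow> Q {k, l})" for Q
    using assms unfolding simple_graph_def by metis
  have "(\<forall>k l. {k, l} \<in> E \<longrightarrow> gcd (n k) (n l) = 1) \<longleftrightarrow>
        (\<forall>p\<in>UNIV. prime p \<longrightarrow> (\<forall>e\<in>E. \<exists>j\<in>e. \<not> p dvd n j))" for n :: "'a \<Rightarrow> nat"
    unfolding edges coprime by auto
  hence "{n. (\<forall>j. n j \<ge> 1) \<and> (\<forall>k l. {k, l} \<in> E \<longrightarrow> gcd (n k) (n l) = 1)} = sieved UNIV E"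
    by (simp only: sieved_def)
  thus ?thesis
    by (simp only: D_G_def dirichlet_term_def[abs_def])
qed

section \<open>Half-spaces\<close>

lemma open_half_space: "open (half_space a :: (complex ^ 'n::finite) set)"
proof -
  have "half_space a = (\<Inter>j\<in>UNIV. {s :: complex ^ 'n. Re (s $ j) > a})"
    by (auto simp: half_space_def)
  moreover have "open {s :: complex ^ 'n. Re (s $ j) > a}" for j
    by (intro open_Collect_less continuous_intros)
  ultimately show ?thesis
    by (simp add: open_INT)
qed

lemma convex_half_space: "convex (half_space a :: (complex ^ 'n::finite) set)"
proof -
  have "half_space a = (\<Inter>j\<in>UNIV. (\<lambda>s :: complex ^ 'n. Re (s $ j)) -` {a<..})"
    by (auto simp: half_space_def)
  moreover have "convex ((\<lambda>s :: complex ^ 'n. Re (s $ j)) -` {a<..})" for j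
    by (intro convex_linear_vimage) (auto intro!: linearI)
  ultimately show ?thesis
    by (auto intro!: convex_INT)
qed

lemma half_space_ne: "half_space a \<noteq> {}"
proof -
  have "(\<chi> j. of_real (a + 1)) \<in> half_space a"
    by (simp add: half_space_def)
  thus ?thesis by blast
qed

lemma half_space_mono: "b \<le> a \<Longrightarrow> half_space a \<subseteq> half_space b"
  by (auto simp: half_space_def intro: le_less_trans)

text \<open>
  Uniform bounds for the Euler factors are available only at a positive distance from the boundary of
  the half-space; each point lies in a smaller half-space with such a distance.
\<close>

lemma ex_half_space_around:
  assumes "s \<in> half_space a"
  obtains b where "b > a" "s \<in> half_space b"
proof -
  define m where "m = Min (range (\<lambda>j. Re (s $ j)))"
  have "m > a"
    unfolding m_def using assms by (subst Min_gr_iff) (auto simp: half_space_def)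
  moreover have "m \<le> Re (s $ j)" for j
    unfolding m_def by (rule Min_le) auto
  ultimately have "(a + m) / 2 > a" "(a + m) / 2 < Re (s $ j)" for j :: 'a
  proof -
    have "(a + m) / 2 > a" "(a + m) / 2 < m"
      using \<open>m > a\<close> by simp_all
    thus "(a + m) / 2 > a" "(a + m) / 2 < Re (s $ j)"
      using \<open>m \<le> Re (s $ j)\<close> by simp_all
  qed
  hence "(a + m) / 2 > a" "s \<in> half_space ((a + m) / 2)"
    by (simp_all add: half_space_def)
  thus ?thesis
    by (rule that)
qed

section \<open>Analytic functions of several variables\<close>

lemma analytic_on_open_cong:
  assumes "analytic_on_open f S" "\<And>x. x \<in> S \<Longrightarrow> f x = g x"
  shows   "analytic_on_open g S"
  using assms unfolding analytic_on_open_def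
  by (metis (no_types, lifting) has_derivative_transform_within_open)

lemma analytic_on_open_subset:
  assumes "analytic_on_open f S" "T \<subseteq> S" "open T"
  shows   "analytic_on_open f T"
  using assms unfolding analytic_on_open_def by blast

lemma analytic_on_open_locally:
  assumes "open S" "\<And>s. s \<in> S \<Longrightarrow> \<exists>T. s \<in> T \<and> analytic_on_open f T"
  shows   "analytic_on_open f S"
  using assms unfolding analytic_on_open_def by blast

lemma analytic_on_open_mult:
  assumes "analytic_on_open f S" "analytic_on_open g S"
  shows   "analytic_on_open (\<lambda>x. f x * g x) S"
  unfolding analytic_on_open_def
proof (intro conjI ballI)
  show "open S"
    using assms by (simp add: analytic_on_open_def)
  fix s assume "s \<in> S"
  with assms obtain f' g' where
    "(f has_derivative f') (at s)" "\<And>c v. f' (c *s v) = c * f' v"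
    "(g has_derivative g') (at s)" "\<And>c v. g' (c *s v) = c * g' v"
    unfolding analytic_on_open_def by metis
  thus "\<exists>D. ((\<lambda>x. f x * g x) has_derivative D) (at s) \<and> (\<forall>c v. D (c *s v) = c * D v)"
    by (intro exI[of _ "\<lambda>h. f s * g' h + f' h * g s"])
       (auto intro!: has_derivative_mult simp: algebra_simps)
qed

lemma analytic_on_open_prod:
  assumes "open S" "\<And>i. i \<in> I \<Longrightarrow> analytic_on_open (f i) S"
  shows   "analytic_on_open (\<lambda>x. \<Prod>i\<in>I. f i x) S"
  using assms(2)
proof (induction I rule: infinite_finite_induct)
  case (insert i I)
  thus ?case
    using analytic_on_open_mult[of "f i" S "\<lambda>x. \<Prod>i\<in>I. f i x"] by simp
qed (use assms(1) in \<open>auto simp: analytic_on_open_def intro!: exI[of _ "\<lambda>_. 0"]\<close>)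

lemma analytic_on_open_exp:
  assumes "analytic_on_open f S"
  shows   "analytic_on_open (\<lambda>x. exp (f x)) S"
  unfolding analytic_on_open_def
proof (intro conjI ballI)
  show "open S"
    using assms by (simp add: analytic_on_open_def)
  fix s assume "s \<in> S"
  with assms obtain f' where f': "(f has_derivative f') (at s)" "\<And>c v. f' (c *s v) = c * f' v"
    unfolding analytic_on_open_def by metis
  have "((\<lambda>x. exp (f x)) has_derivative (\<lambda>h. exp (f s) * f' h)) (at s)"
    using has_derivative_compose[OF f'(1) DERIV_exp[THEN has_field_derivative_imp_has_derivative]]
    by simp
  thus "\<exists>D. ((\<lambda>x. exp (f x)) has_derivative D) (at s) \<and> (\<forall>c v. D (c *s v) = c * D v)"
    by (intro exI conjI) (auto simp: f'(2))
qed

text \<open>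
  In several variables analyticity of a limit is not a formal consequence of uniform convergence of
  the functions, so the derivatives are majorized as well; the series may then be differentiated term
  by term, and complex linearity survives the summation.
\<close>

lemma analytic_on_open_suminf:
  fixes f :: "nat \<Rightarrow> complex ^ 'n::finite \<Rightarrow> complex"
  assumes S: "open S" "convex S" and M: "summable M"
    and f': "\<And>n x. x \<in> S \<Longrightarrow> (f n has_derivative f' n x) (at x)"
    and lin: "\<And>n x c v. x \<in> S \<Longrightarrow> f' n x (c *s v) = c * f' n x v"
    and f_le: "\<And>n x. x \<in> S \<Longrightarrow> norm (f n x) \<le> M n"
    and f'_le: "\<And>n x h. x \<in> S \<Longrightarrow> norm (f' n x h) \<le> M n * norm h"
  shows "analytic_on_open (\<lambda>x. \<Sum>n. f n x) S"
  unfolding analytic_on_open_def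
proof (intro conjI ballI)
  fix s assume s: "s \<in> S"
  define g' where "g' = (\<lambda>x h. \<Sum>n. f' n x h)"
  have sum_f: "summable (\<lambda>n. f n x)" if "x \<in> S" for x
    by (rule summable_comparison_test'[OF M, of 0]) (use f_le that in auto)
  have sum_f': "summable (\<lambda>n. f' n x h)" if "x \<in> S" for x h
    by (rule summable_comparison_test'[OF summable_mult2[OF M, of "norm h"], of 0])
       (use f'_le that in auto)
  have M_nonneg: "M n \<ge> 0" for n
    using f_le[OF s, of n] norm_ge_zero order_trans by blast
  have uniform: "\<forall>\<^sub>F n in sequentially. \<forall>x\<in>S. \<forall>h :: complex ^ 'n.
                   norm ((\<Sum>i<n. f' i x h) - g' x h) \<le> e * norm h" if e: "e > 0" for e
  proof -
    have "(\<lambda>n. \<Sum>i. M (i + n)) \<longlonglongrightarrow> 0"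
      using M by (rule suminf_exist_split2)
    hence "\<forall>\<^sub>F n in sequentially. (\<Sum>i. M (i + n)) < e"
      using e by (rule order_tendstoD(2))
    thus ?thesis
    proof eventually_elim
      case (elim n)
      show ?case
      proof (intro ballI allI)
        fix x h :: "complex ^ 'n" assume x: "x \<in> S"
        have sum_tail: "summable (\<lambda>i. M (i + n) * norm h)"
          by (intro summable_mult2 summable_ignore_initial_segment M)
        have "norm ((\<Sum>i<n. f' i x h) - g' x h) = norm (\<Sum>i. f' (i + n) x h)"
          using suminf_minus_initial_segment[OF sum_f'[OF x, of h], of n]
          by (simp add: g'_def norm_minus_commute)
        also have "\<dots> \<le> (\<Sum>i. M (i + n) * norm h)"
          by (rule norm_suminf_le[OF f'_le[OF x] sum_tail])
        also have "\<dots> = (\<Sum>i. M (i + n)) * norm h"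
          by (intro suminf_mult2[symmetric] summable_ignore_initial_segment M)
        also have "\<dots> \<le> e * norm h"
          using elim by (intro mult_right_mono) auto
        finally show "norm ((\<Sum>i<n. f' i x h) - g' x h) \<le> e * norm h" .
      qed
    qed
  qed
  have "\<exists>g. \<forall>x\<in>S. (\<lambda>n. f n x) sums g x \<and> (g has_derivative g' x) (at x within S)"
    by (rule has_derivative_series[where f = f and f' = f' and g' = g',
               OF S(2) has_derivative_at_withinI[OF f'] uniform s summable_sums[OF sum_f[OF s]]])
  then obtain g where g: "\<And>x. x \<in> S \<Longrightarrow> (\<lambda>n. f n x) sums g x"
      "\<And>x. x \<in> S \<Longrightarrow> (g has_derivative g' x) (at x within S)"
    by blast
  have "((\<lambda>x. \<Sum>n. f n x) has_derivative g' s) (at s)"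
  proof (rule has_derivative_transform_within_open[OF _ S(1) s])
    show "(g has_derivative g' s) (at s)"
      using g(2)[OF s] at_within_open[OF s S(1)] by simp
  qed (use g(1) sums_unique in blast)
  moreover have "g' s (c *s v) = c * g' s v" for c v
    using suminf_mult[OF sum_f'[OF s, of v], of c] by (simp add: g'_def lin[OF s])
  ultimately show "\<exists>D. ((\<lambda>x. \<Sum>n. f n x) has_derivative D) (at s) \<and>
                      (\<forall>c v. D (c *s v) = c * D v)"
    by blast
qed (rule S)

text \<open>
  Factors may vanish, so the product is not the exponential of a sum of logarithms throughout.  From
  some index \<open>N\<close> on, however, all factors are within \<open>1/2\<close> of \<open>1\<close> on the whole of \<open>S\<close>, and the tail is such an
  exponential; the finitely many remaining factors are multiplied in afterwards.
\<close>

lemma analytic_on_open_prodinf: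
  fixes f :: "nat \<Rightarrow> complex ^ 'n::finite \<Rightarrow> complex"
  assumes S: "open S" "convex S" and M: "summable M"
    and f': "\<And>n x. x \<in> S \<Longrightarrow> (f n has_derivative f' n x) (at x)"
    and lin: "\<And>n x c v. x \<in> S \<Longrightarrow> f' n x (c *s v) = c * f' n x v"
    and f_le: "\<And>n x. x \<in> S \<Longrightarrow> norm (f n x - 1) \<le> M n"
    and f'_le: "\<And>n x h. x \<in> S \<Longrightarrow> norm (f' n x h) \<le> M n * norm h"
  shows "analytic_on_open (\<lambda>x. prodinf (\<lambda>n. f n x)) S"
proof -
  have "M \<longlonglongrightarrow> 0"
    using M by (rule summable_LIMSEQ_zero)
  hence "\<forall>\<^sub>F n in sequentially. M n < 1/2"
    by (rule order_tendstoD(2)) simp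
  then obtain N where N: "\<And>n. n \<ge> N \<Longrightarrow> M n < 1/2"
    by (auto simp: eventually_sequentially)
  define L where "L = (\<lambda>n x. Ln (f (n + N) x))"
  have small: "norm (f (n + N) x - 1) < 1/2" if "x \<in> S" for n x
    using f_le[OF that, of "n + N"] N[of "n + N"] by simp
  have Re_pos: "Re (f (n + N) x) > 1/2" if "x \<in> S" for n x
    using small[OF that, of n] abs_Re_le_cmod[of "f (n + N) x - 1"] by simp
  hence nz: "f (n + N) x \<noteq> 0" if "x \<in> S" for n x
    using Re_pos[OF that, of n] by fastforce
  have norm_ge: "norm (f (n + N) x) \<ge> 1/2" if "x \<in> S" for n x
    using Re_pos[OF that, of n] complex_Re_le_cmod[of "f (n + N) x"] by simp
  have L_le: "norm (L n x) \<le> 2 * M (n + N)" if "x \<in> S" for n x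
    using norm_Ln_le[OF small[OF that, of n]] f_le[OF that, of "n + N"] by (simp add: L_def)
  have sum_2M: "summable (\<lambda>n. 2 * M (n + N))"
    by (intro summable_mult summable_ignore_initial_segment M)
  have "analytic_on_open (\<lambda>x. \<Sum>n. L n x) S"
  proof (rule analytic_on_open_suminf[OF S sum_2M])
    fix n x assume x: "x \<in> S"
    have "f (n + N) x \<notin> \<real>\<^sub>\<le>\<^sub>0"
      using Re_pos[OF x, of n] by (auto simp: complex_nonpos_Reals_iff)
    hence "(Ln has_derivative (*) (inverse (f (n + N) x))) (at (f (n + N) x))"
      by (intro has_field_derivative_imp_has_derivative has_field_derivative_Ln)
    from has_derivative_compose[OF f'[OF x] this]
    show "(L n has_derivative (\<lambda>h. inverse (f (n + N) x) * f' (n + N) x h)) (at x)"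
      by (simp add: L_def)
    show "inverse (f (n + N) x) * f' (n + N) x (c *s v)
            = c * (inverse (f (n + N) x) * f' (n + N) x v)" for c v
      by (simp add: lin[OF x])
    show "norm (inverse (f (n + N) x) * f' (n + N) x h) \<le> 2 * M (n + N) * norm h" for h
    proof -
      have "inverse (norm (f (n + N) x)) \<le> 2"
        using le_imp_inverse_le[OF norm_ge[OF x, of n]] by simp
      hence "inverse (norm (f (n + N) x)) * norm (f' (n + N) x h) \<le> 2 * (M (n + N) * norm h)"
        using f'_le[OF x] by (intro mult_mono) auto
      thus ?thesis
        by (simp add: norm_mult norm_inverse)
    qed
  qed (rule L_le)
  moreover have "analytic_on_open (f i) S" for i
    unfolding analytic_on_open_def using S(1) f' lin by blast
  ultimately have "analytic_on_open (\<lambda>x. (\<Prod>i<N. f i x) * exp (\<Sum>n. L n x)) S"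
    by (intro analytic_on_open_mult analytic_on_open_prod analytic_on_open_exp S(1)) simp_all
  moreover have "(\<Prod>i<N. f i x) * exp (\<Sum>n. L n x) = prodinf (\<lambda>n. f n x)" if x: "x \<in> S" for x
  proof (rule LIMSEQ_unique)
    have "summable (\<lambda>n. norm (f n x - 1))"
      by (rule summable_comparison_test'[OF M, of 0]) (use f_le[OF x] in auto)
    hence "convergent_prod (\<lambda>n. f n x)"
      by (intro abs_convergent_prod_imp_convergent_prod summable_imp_abs_convergent_prod)
    hence "(\<lambda>n. \<Prod>i<n. f i x) \<longlonglongrightarrow> prodinf (\<lambda>n. f n x)"
      using convergent_prod_LIMSEQ LIMSEQ_lessThan_iff_atMost by blast
    thus "(\<lambda>n. \<Prod>i<n + N. f i x) \<longlonglongrightarrow> prodinf (\<lambda>n. f n x)"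
      by (rule LIMSEQ_ignore_initial_segment)
    have "summable (\<lambda>n. L n x)"
      by (rule summable_comparison_test'[OF sum_2M, of 0]) (use L_le[OF x] in auto)
    hence "(\<lambda>n. \<Sum>i<n. L i x) \<longlonglongrightarrow> (\<Sum>n. L n x)"
      by (rule summable_LIMSEQ)
    hence "(\<lambda>n. (\<Prod>i<N. f i x) * exp (\<Sum>i<n. L i x)) \<longlonglongrightarrow> (\<Prod>i<N. f i x) * exp (\<Sum>n. L n x)"
      by (intro tendsto_intros)
    moreover have "(\<Prod>i<N. f i x) * exp (\<Sum>i<n. L i x) = (\<Prod>i<n + N. f i x)" for n
      by (induction n) (simp_all add: exp_add L_def nz[OF x] mult_ac)
    ultimately show "(\<lambda>n. \<Prod>i<n + N. f i x) \<longlonglongrightarrow> (\<Prod>i<N. f i x) * exp (\<Sum>n. L n x)"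
      by simp
  qed
  ultimately show ?thesis
    by (rule analytic_on_open_cong)
qed

section \<open>Bounds for the Euler factors\<close>

text \<open>
  This is the Frechet derivative of the Euler factor at \<open>p\<close> in the variable \<open>s\<close>: the product over
  \<open>ver U\<close> is the exponential of \<open>- ln p\<close> times the sum of the \<open>s\<^sub>j\<close>.
\<close>

definition euler_deriv ::
  "'n::finite set set \<Rightarrow> complex ^ 'n \<Rightarrow> nat \<Rightarrow> complex ^ 'n \<Rightarrow> complex" where
  "euler_deriv E s p h = (\<Sum>U\<in>Pow E. (- 1) ^ card U *
     (- of_real (ln (real p)) * (\<Sum>j\<in>ver U. h $ j) * (\<Prod>j\<in>ver U. of_nat p powr (- (s $ j)))))"

lemma has_derivative_powr_prod:
  fixes s :: "complex ^ 'n::finite"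
  assumes "p > 0"
  shows "((\<lambda>s. \<Prod>j\<in>W. of_nat p powr (- (s $ j))) has_derivative
           (\<lambda>h. - of_real (ln (real p)) * (\<Sum>j\<in>W. h $ j) * (\<Prod>j\<in>W. of_nat p powr (- (s $ j)))))
           (at s)"
proof -
  have eq: "(\<Prod>j\<in>W. of_nat p powr (- (s $ j))) = exp (- of_real (ln (real p)) * (\<Sum>j\<in>W. s $ j))"
    for s :: "complex ^ 'n"
  proof -
    have "Ln (of_nat p) = of_real (ln (real p))"
      using assms Ln_of_real[of "real p"] by simp
    hence "(\<Prod>j\<in>W. of_nat p powr (- (s $ j))) = exp (\<Sum>j\<in>W. - (s $ j) * of_real (ln (real p)))"
      using assms by (simp add: powr_def exp_sum)
    thus ?thesis
      by (simp add: sum_negf sum_distrib_right mult.commute)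
  qed
  have "((\<lambda>s. - of_real (ln (real p)) * (\<Sum>j\<in>W. s $ j)) has_derivative
           (\<lambda>h. - of_real (ln (real p)) * (\<Sum>j\<in>W. h $ j))) (at s)"
    by (intro has_derivative_mult_right has_derivative_sum bounded_linear_imp_has_derivative
          bounded_linear_vec_nth)
  from has_derivative_compose[OF this DERIV_exp[THEN has_field_derivative_imp_has_derivative]]
  show ?thesis
    unfolding eq by (simp only: mult_ac)
qed

lemma has_derivative_euler_factor:
  assumes "p > 0"
  shows "((\<lambda>s. euler_factor E s p) has_derivative euler_deriv E s p) (at s)"
  unfolding euler_factor_def euler_deriv_def
  by (rule has_derivative_sum, rule has_derivative_mult_right, rule has_derivative_powr_prod,
      rule assms)

text \<open>
  This is the source of the abscissa \<open>1/2\<close>: as an edge has two endpoints, every term of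
  an Euler factor other than the leading \<open>1\<close> contains at least two factors \<open>p powr (-s\<^sub>j)\<close>.
\<close>

lemma card_ver_ge_2:
  assumes "simple_graph E" "U \<subseteq> E" "U \<noteq> {}"
  shows   "card (ver U :: 'n::finite set) \<ge> 2"
proof -
  from assms(3) obtain e where e: "e \<in> U" by blast
  from assms(2) this have "e \<in> E" by (rule subsetD)
  with assms(1) have "\<exists>k l. k \<noteq> l \<and> e = {k, l}"
    unfolding simple_graph_def by (rule bspec)
  then obtain k l where "k \<noteq> l" "e = {k, l}" by blast
  hence "card e = 2" by simp
  moreover have "e \<subseteq> ver U"
    using e by (auto simp: ver_def)
  ultimately show ?thesis
    using card_mono[of "ver U" e] by simp
qed

lemma norm_powr_prod_le:
  fixes s :: "complex ^ 'n::finite"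
  assumes s: "s \<in> half_space a" and a: "a > 0" and p: "p > 0" and W: "card W \<ge> 2"
  shows "norm (\<Prod>j\<in>W. of_nat p powr (- (s $ j))) \<le> real p powr (- 2 * a)"
proof -
  have p1: "real p \<ge> 1" using p by simp
  have "norm (\<Prod>j\<in>W. of_nat p powr (- (s $ j))) = (\<Prod>j\<in>W. real p powr (- Re (s $ j)))"
    by (simp add: prod_norm[symmetric] norm_powr_real_powr)
  also have "\<dots> \<le> (\<Prod>j\<in>W. real p powr (- a))"
    using s p1 by (intro prod_mono conjI powr_mono) (auto simp: half_space_def less_imp_le)
  also have "\<dots> = real p powr (- a * real (card W))"
    using p by (simp add: powr_power mult.commute)
  also have "\<dots> \<le> real p powr (- 2 * a)"
    using p1 W a by (intro powr_mono) auto
  finally show ?thesis .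
qed

text \<open>
  A common bound for the deviation of the Euler factor from \<open>1\<close> and for the norm of its derivative on
  \<open>half_space a\<close>: the number of subsets of \<open>E\<close> bounds the number of terms, and differentiation costs a
  factor of at most \<open>CARD('n) * ln p\<close>.
\<close>

definition euler_majorant :: "'n::finite set set \<Rightarrow> real \<Rightarrow> nat \<Rightarrow> real" where
  "euler_majorant E a p =
     real (card (Pow E)) * real CARD('n) * (1 + ln (real p)) * real p powr (- 2 * a)"

lemma summable_euler_majorant:
  assumes "a > 1/2"
  shows   "summable (euler_majorant E a)"
proof -
  \<comment> \<open>the logarithm is absorbed by \<open>p powr d\<close>, and \<open>d\<close> is half of the room between \<open>2 * a\<close> and \<open>1\<close>\<close>
  define d where "d = a - 1/2"
  have d: "d > 0" "d - 2 * a < -1"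
    using assms by (auto simp: d_def)
  have "summable (\<lambda>p. (1 + ln (real p)) * real p powr (- 2 * a))"
  proof (rule summable_comparison_test')
    show "summable (\<lambda>p. (1 + 1 / d) * real p powr (d - 2 * a))"
      using d by (intro summable_mult) (simp add: summable_real_powr_iff)
    fix p :: nat
    show "norm ((1 + ln (real p)) * real p powr (- 2 * a)) \<le> (1 + 1 / d) * real p powr (d - 2 * a)"
    proof (cases "p = 0")
      case False
      hence p: "real p \<ge> 1" by simp
      have "1 + ln (real p) \<le> real p powr d + real p powr d / d"
        using p d by (intro add_mono ln_powr_bound ge_one_powr_ge_zero) auto
      hence "(1 + ln (real p)) * real p powr (- 2 * a)
          \<le> ((1 + 1 / d) * real p powr d) * real p powr (- 2 * a)"
        by (intro mult_right_mono) (auto simp: algebra_simps)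
      also have "\<dots> = (1 + 1 / d) * real p powr (d - 2 * a)"
        by (simp only: mult.assoc powr_add[symmetric]) simp
      finally show ?thesis
        using p by simp
    qed simp
  qed
  from summable_mult[OF this, of "real (card (Pow E)) * real CARD('a)"] show ?thesis
    by (simp only: euler_majorant_def[abs_def] mult.assoc)
qed

lemma euler_factor_bounds:
  fixes E :: "'n::finite set set"
  assumes E: "simple_graph E" and s: "s \<in> half_space a" and a: "a > 0" and p: "p > 0"
  shows "norm (euler_factor E s p - 1) \<le> euler_majorant E a p"
    and "norm (euler_deriv E s p h) \<le> euler_majorant E a p * norm h"
proof -
  let ?x = "real p powr (- 2 * a)"
  have ln: "ln (real p) \<ge> 0"
    using p by simp
  have term_le: "norm (\<Prod>j\<in>ver U. of_nat p powr (- (s $ j))) \<le> ?x" if "U \<subseteq> E" "U \<noteq> {}" for U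
    using card_ver_ge_2[OF E that] by (rule norm_powr_prod_le[OF s a p])
  have ver_empty: "ver {} = ({} :: 'n set)"
    by (simp add: ver_def)

  have "euler_factor E s p
      = 1 + (\<Sum>U\<in>Pow E - {{}}. (- 1) ^ card U * (\<Prod>j\<in>ver U. of_nat p powr (- (s $ j))))"
    unfolding euler_factor_def by (subst sum.remove[of _ "{}"]) (auto simp: ver_empty)
  hence "norm (euler_factor E s p - 1)
      \<le> (\<Sum>U\<in>Pow E - {{}}. norm ((- 1) ^ card U * (\<Prod>j\<in>ver U. of_nat p powr (- (s $ j)))))"
    by (simp only: add_diff_cancel_left' norm_sum)
  also have "\<dots> \<le> (\<Sum>U\<in>Pow E - {{}}. ?x)"
    using term_le by (intro sum_mono) (simp add: norm_mult norm_power)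
  also have "\<dots> \<le> (\<Sum>U\<in>Pow E. ?x)"
    by (intro sum_mono2) auto
  also have "\<dots> = real (card (Pow E)) * 1 * 1 * ?x"
    by simp
  also have "\<dots> \<le> euler_majorant E a p"
    unfolding euler_majorant_def using ln
    by (intro mult_right_mono mult_mono) (auto simp: Suc_le_eq)
  finally show "norm (euler_factor E s p - 1) \<le> euler_majorant E a p" .

  have "norm (\<Sum>j\<in>W. h $ j) \<le> real CARD('n) * norm h" for W
  proof -
    have "norm (\<Sum>j\<in>W. h $ j) \<le> (\<Sum>j\<in>W. norm h)"
      by (intro sum_norm_le Finite_Cartesian_Product.norm_nth_le)
    also have "\<dots> \<le> (\<Sum>j\<in>(UNIV :: 'n set). norm h)"
      by (intro sum_mono2) auto
    finally show ?thesis by simp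
  qed
  note sum_le = this
  have "norm ((- 1) ^ card U * (- of_real (ln (real p)) * (\<Sum>j\<in>ver U. h $ j)
           * (\<Prod>j\<in>ver U. of_nat p powr (- (s $ j)))))
         \<le> ln (real p) * (real CARD('n) * norm h) * ?x" if "U \<subseteq> E" for U
  proof (cases "U = {}")
    case True
    thus ?thesis
      using ln by (simp add: ver_empty)
  next
    case False
    have "ln (real p) * norm (\<Sum>j\<in>ver U. h $ j) * norm (\<Prod>j\<in>ver U. of_nat p powr (- (s $ j)))
        \<le> ln (real p) * (real CARD('n) * norm h) * ?x"
      by (intro mult_mono[OF mult_left_mono[OF sum_le ln] term_le[OF that False]]
            mult_nonneg_nonneg ln norm_ge_zero of_nat_0_le_iff)
    thus ?thesis
      using ln by (simp add: norm_mult norm_power)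
  qed
  hence "norm (euler_deriv E s p h) \<le> (\<Sum>U\<in>Pow E. ln (real p) * (real CARD('n) * norm h) * ?x)"
    unfolding euler_deriv_def by (intro sum_norm_le) simp
  also have "\<dots> = real (card (Pow E)) * real CARD('n) * ln (real p) * ?x * norm h"
    by simp
  also have "\<dots> \<le> euler_majorant E a p * norm h"
    unfolding euler_majorant_def using ln
    by (intro mult_right_mono mult_left_mono) auto
  finally show "norm (euler_deriv E s p h) \<le> euler_majorant E a p * norm h" .
qed

lemma norm_prime_factor_seq_le:
  assumes "simple_graph E" "s \<in> half_space a" "a > 0"
  shows "norm (prime_factor_seq (euler_factor E s) p - 1) \<le> euler_majorant E a p"
proof (cases "prime p")
  case True
  thus ?thesis
    using euler_factor_bounds(1)[OF assms prime_gt_0_nat] by (simp add: prime_factor_seq_def)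
next
  case False
  \<comment> \<open>this includes \<open>p = 0\<close>, where \<open>ln 0 = 0\<close> by convention\<close>
  have "ln (real p) \<ge> 0"
    by (cases "p = 0") auto
  thus ?thesis
    using False by (simp add: prime_factor_seq_def euler_majorant_def)
qed

section \<open>The Euler product\<close>

lemma abs_convergent_euler_product:
  assumes E: "simple_graph E" and s: "s \<in> half_space (1/2)"
  shows   "abs_convergent_prod (prime_factor_seq (euler_factor E s))"
proof -
  from s obtain a where a: "a > 1/2" "s \<in> half_space a"
    by (rule ex_half_space_around)
  show ?thesis
    by (intro summable_imp_abs_convergent_prod
          summable_comparison_test'[OF summable_euler_majorant[OF a(1)], of 0])
       (use norm_prime_factor_seq_le[OF E a(2)] a(1) in auto)
qed

lemma analytic_euler_product:
  fixes E :: "'n::finite set set"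
  assumes E: "simple_graph E"
  shows "analytic_on_open (\<lambda>s. prodinf (prime_factor_seq (euler_factor E s))) (half_space (1/2))"
proof (rule analytic_on_open_locally[OF open_half_space])
  fix s :: "complex ^ 'n" assume "s \<in> half_space (1/2)"
  then obtain a where a: "a > 1/2" "s \<in> half_space a"
    by (rule ex_half_space_around)
  define f' where "f' = (\<lambda>p (s :: complex ^ 'n) h. if prime p then euler_deriv E s p h else 0)"
  have "analytic_on_open (\<lambda>s. prodinf (\<lambda>p. prime_factor_seq (euler_factor E s) p)) (half_space a)"
  proof (rule analytic_on_open_prodinf[OF open_half_space convex_half_space
           summable_euler_majorant[OF a(1)], where f' = f'])
    fix p :: nat and s :: "complex ^ 'n" assume s: "s \<in> half_space a"
    show "((\<lambda>s. prime_factor_seq (euler_factor E s) p) has_derivative f' p s) (at s)"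
      using has_derivative_euler_factor[of p E s]
      by (cases "prime p") (simp_all add: prime_factor_seq_def f'_def prime_gt_0_nat)
    show "f' p s (c *s v) = c * f' p s v" for c v
      by (simp add: f'_def euler_deriv_def sum_distrib_left mult_ac)
    show "norm (prime_factor_seq (euler_factor E s) p - 1) \<le> euler_majorant E a p"
      using norm_prime_factor_seq_le[OF E s] a(1) by simp
    show "norm (f' p s h) \<le> euler_majorant E a p * norm h" for h
    proof (cases "prime p")
      case True
      thus ?thesis
        using euler_factor_bounds(2)[OF E s _ prime_gt_0_nat] a(1) by (simp add: f'_def)
    next
      case False
      have "0 \<le> euler_majorant E a p"
        using order_trans[OF norm_ge_zero norm_prime_factor_seq_le[OF E s]] a(1) by simp
      thus ?thesis
        using False by (simp add: f'_def)
    qed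
  qed
  with a(2) show "\<exists>T. s \<in> T \<and>
      analytic_on_open (\<lambda>s. prodinf (prime_factor_seq (euler_factor E s))) T"
    by auto
qed

theorem theorem5:
  fixes E :: "'n::finite set set"
  assumes "simple_graph E"
  shows "(\<forall>s \<in> half_space 1.
            (\<Prod>j\<in>UNIV. inverse (zeta (s $ j))) * D_G E s
              = prodinf (prime_factor_seq (euler_factor E s))) \<and>
         (\<forall>s \<in> half_space (1/2).
            abs_convergent_prod (prime_factor_seq (euler_factor E s))) \<and>
         analytic_continuation (Xi_G E) (half_space 1)
           (\<lambda>s. prodinf (prime_factor_seq (euler_factor E s))) (half_space (1/2))"
proof -
  let ?P = "\<lambda>s. prodinf (prime_factor_seq (euler_factor E s))"
  have mono: "half_space 1 \<subseteq> (half_space (1/2) :: (complex ^ 'n) set)"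
    by (rule half_space_mono) simp
  have conv: "abs_convergent_prod (prime_factor_seq (euler_factor E s))"
    if "s \<in> half_space (1/2)" for s
    using abs_convergent_euler_product[OF assms that] .
  have eq: "Xi_G E s = ?P s" if s: "s \<in> half_space 1" for s
  proof -
    let ?Z = "\<Prod>j\<in>UNIV. zeta (s $ j)"
    have "(\<lambda>N. \<Prod>p<N. prime_factor_seq (euler_factor E s) p) \<longlonglongrightarrow> ?P s"
      using convergent_prod_LIMSEQ[OF abs_convergent_prod_imp_convergent_prod[OF conv]]
            mono s LIMSEQ_lessThan_iff_atMost by blast
    hence "(\<lambda>N. (\<Prod>p<N. prime_factor_seq (euler_factor E s) p) * ?Z) \<longlonglongrightarrow> ?P s * ?Z"
      by (intro tendsto_mult_right)
    moreover have "(\<lambda>N. (\<Prod>p<N. prime_factor_seq (euler_factor E s) p) * ?Z) \<longlonglongrightarrow> D_G E s"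
      using sieved_products_tendsto[OF s, of E] by (simp only: D_G_eq_infsum_sieved[OF assms])
    ultimately have "D_G E s = ?P s * ?Z"
      using LIMSEQ_unique by blast
    moreover have "?Z \<noteq> 0"
      by (rule prod_zeta_nonzero[OF s])
    ultimately show ?thesis
      by (simp add: Xi_G_def prod_inversef[unfolded o_def])
  qed
  have "analytic_continuation (Xi_G E) (half_space 1) ?P (half_space (1/2))"
    unfolding analytic_continuation_def
  proof (intro conjI ballI)
    have an: "analytic_on_open ?P (half_space (1/2))"
      by (rule analytic_euler_product[OF assms])
    show "analytic_on_open ?P (half_space (1/2))" by (fact an)
    show "analytic_on_open (Xi_G E) (half_space 1)"
      by (rule analytic_on_open_cong[OF analytic_on_open_subset[OF an mono open_half_space]])
         (simp add: eq)
    show "?P s = Xi_G E s" if "s \<in> half_space 1" for s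
      using eq[OF that] by simp
  qed (use mono in \<open>auto simp: half_space_ne convex_connected convex_half_space\<close>)
  thus ?thesis
    using eq conv by (auto simp: Xi_G_def)
qed

end
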